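(* Let $G$ be a finite reflection group acting on $\mathbb{R}^n$ with closed fundamental chamber $\mathcal{C}$, and let $C\subset\mathbb{R}^n$ be a $G$-invariant set (that is, $gC=C$ for all $g\in G$) with the property $$\forall x\in\operatorname{bd}C:\quad \operatorname{co}\mathcal{O}(x)\subseteq C.$$ Then for all $x\in C$ and $y\in\mathbb{R}^n$, $y\in\hat N_C(x)$ if and only if $\check y\in\hat N_C(\check x)$ and $\langle\check x,\check y\rangle=\langle x,y\rangle$.
   Context: A finite reflection group $G$ on $\mathbb{R}^n$ is a finite subgroup of the orthogonal group $O(n)$ generated by reflections $h_u$, $h_u x=(I-2uu^{T})x$, $u$ a unit vector. Its root system is $\Phi=\{u:\|u\|=1,\ h_u\in G\}$. A positive root system is a set $U\subset\Phi$ for which there is a linear functional $\ell:\mathbb{R}^n\to\mathbb{R}$ with $\ell(u)>0$ for all $u\in U$ and $\ell(u)<0$ for all $u\in\Phi\setminus U$. Fix a positive root system $U$; the closed fundamental chamber is $\mathcal{C}=\{x\in\mathbb{R}^n:\langle x,u\rangle\ge 0\ \forall u\in U\}$. The orbit of $x$ is $\mathcal{O}(x)=\{gx: g\in G\}$. It is a known fact that $\mathcal{O}(x)\cap\mathcal{C}$ is a singleton for every $x\in\mathbb{R}^n$; its unique element is denoted $\check x$. Here $\langle x,y\rangle=x^{T}y$, $\|\cdot\|$ is the Euclidean norm, $\operatorname{co}$ is the convex hull and $\operatorname{bd}$ the topological boundary. The projection is $\mathcal{P}_C(x)=\{y\in C:\|x-y\|=\min_{z\in C}\|x-z\|\}$.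 The proximal normal cone to $C$ at $x\in C$ is $\hat N_C(x)=\{\lambda(z-x):\lambda\ge 0,\ x\in\mathcal{P}_C(z)\}$; equivalently $y\in\hat N_C(x)$ iff there is $\alpha>0$ with $x\in\mathcal{P}_C(x+\alpha y)$. *)

theory Defs
  imports "HOL-Analysis.Analysis" "HOL-Algebra.Generated_Groups"
begin

definition orthogonal_group :: "(real^'n^'n) monoid" where
  "orthogonal_group = \<lparr>carrier = {Q. orthogonal_matrix Q}, mult = (**), one = mat 1\<rparr>"

definition reflection_matrix :: "real^'n \<Rightarrow> real^'n^'n" where
  "reflection_matrix u =
     mat 1 - 2 *\<^sub>R ((columnvector u :: real^1^'n) ** (rowvector u :: real^'n^1))"

lemma reflection_matrix_mult:
  fixes u x :: "real^'n"
  shows "reflection_matrix u *v x = x - (2 * (u \<bullet> x)) *\<^sub>R u"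
proof -
  have "((columnvector u :: real^1^'n) ** (rowvector u :: real^'n^1)) *v x = (u \<bullet> x) *\<^sub>R u"
    by (simp add: vec_eq_iff matrix_vector_mult_def matrix_matrix_mult_def columnvector_def
        rowvector_def inner_vec_def sum_distrib_left mult_ac)
  then show ?thesis
    by (simp add: reflection_matrix_def matrix_vector_mult_diff_rdistrib
        flip: scaleR_matrix_vector_assoc)
qed

text \<open>The generating set may be empty, so the trivial group counts as a reflection group.\<close>

definition finite_reflection_group :: "(real^'n^'n) set \<Rightarrow> bool" where
  "finite_reflection_group G \<longleftrightarrow>
     finite G \<and> subgroup G orthogonal_group \<and>
     (\<exists>S. (\<forall>u\<in>S. norm u = 1) \<and> G = generate orthogonal_group (reflection_matrix ` S))"

definition root_system :: "(real^'n^'n) set \<Rightarrow> (real^'n) set" where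
  "root_system G = {u. norm u = 1 \<and> reflection_matrix u \<in> G}"

definition positive_root_system :: "(real^'n^'n) set \<Rightarrow> (real^'n) set \<Rightarrow> bool" where
  "positive_root_system G U \<longleftrightarrow>
     U \<subseteq> root_system G \<and>
     (\<exists>l :: real^'n \<Rightarrow> real. linear l \<and> (\<forall>u\<in>U. l u > 0) \<and> (\<forall>u\<in>root_system G - U. l u < 0))"

definition closed_chamber :: "(real^'n) set \<Rightarrow> (real^'n) set" where
  "closed_chamber U = {x. \<forall>u\<in>U. x \<bullet> u \<ge> 0}"

definition group_orbit :: "(real^'n^'n) set \<Rightarrow> real^'n \<Rightarrow> (real^'n) set" where
  "group_orbit G x = {g *v x | g. g \<in> G}"

text \<open>The description below is proper when \<open>U\<close> is a positive root system of a finite reflection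
  group \<open>G\<close>: every orbit then meets the closed chamber in exactly one point.\<close>

definition chamber_rep :: "(real^'n^'n) set \<Rightarrow> (real^'n) set \<Rightarrow> real^'n \<Rightarrow> real^'n" where
  "chamber_rep G U x = (THE z. z \<in> group_orbit G x \<inter> closed_chamber U)"

definition group_invariant :: "(real^'n^'n) set \<Rightarrow> (real^'n) set \<Rightarrow> bool" where
  "group_invariant G C \<longleftrightarrow> (\<forall>g\<in>G. (\<lambda>x. g *v x) ` C = C)"

text \<open>Set-valued projection: all nearest points. It may be empty or have several elements.\<close>

definition projection_set :: "(real^'n) set \<Rightarrow> real^'n \<Rightarrow> (real^'n) set" where
  "projection_set C x = {y \<in> C. \<forall>z\<in>C. norm (x - y) \<le> norm (x - z)}"

definition proximal_normal_cone :: "(real^'n) set \<Rightarrow> real^'n \<Rightarrow> (real^'n) set" where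
  "proximal_normal_cone C x =
     {c *\<^sub>R (z - x) | (c::real) z. c \<ge> 0 \<and> x \<in> projection_set C z}"

end

theory Submission
  imports Defs
begin

text \<open>A proximal normal \<open>y\<close> to \<open>C\<close> at a boundary point \<open>x\<close> is also normal at \<open>x\<close> to the convex hull
  of the orbit of \<open>x\<close>, so \<open>\<langle>g x, y\<rangle> \<le> \<langle>x, y\<rangle>\<close> for all \<open>g \<in> G\<close>. Taking for \<open>g\<close> the reflections shows
  that no root separates \<open>x\<close> from \<open>y\<close>; hence an element of \<open>G\<close> that moves \<open>x + y\<close> into the chamber
  moves both \<open>x\<close> and \<open>y\<close> there, and the claim follows from the invariance of \<open>C\<close>. Conversely
  the inner product of the chamber representatives of \<open>x\<close> and \<open>y\<close> is the maximum of \<open>\<langle>g x, y\<rangle>\<close> over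
  \<open>g \<in> G\<close>, so equality leads to the same situation. That an orbit meets the chamber only once
  follows from the exchange property of words in simple reflections.\<close>

section \<open>Reflections\<close>

definition reflect :: "'a::real_inner \<Rightarrow> 'a \<Rightarrow> 'a" where
  "reflect u x = x - (2 * (u \<bullet> x)) *\<^sub>R u"

lemma inner_reflect_left: "reflect u x \<bullet> y = x \<bullet> y - 2 * (u \<bullet> x) * (u \<bullet> y)"
  by (simp add: reflect_def inner_diff_left)

lemma inner_reflect_right: "y \<bullet> reflect u x = y \<bullet> x - 2 * (u \<bullet> x) * (u \<bullet> y)"
  using inner_reflect_left[of u x y] by (simp add: inner_commute)

lemma reflect_involution:
  assumes "norm u = 1"
  shows "reflect u (reflect u x) = x"
proof -
  have "u \<bullet> u = 1" using assms by (simp add: norm_eq_1)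
  then show ?thesis by (simp add: reflect_def inner_diff_right algebra_simps)
qed

lemma inner_reflect_reflect:
  assumes "norm u = 1"
  shows "reflect u x \<bullet> reflect u y = x \<bullet> y"
proof -
  have "u \<bullet> u = 1" using assms by (simp add: norm_eq_1)
  then show ?thesis by (simp add: inner_reflect_left inner_reflect_right algebra_simps)
qed

lemma norm_reflect: "norm u = 1 \<Longrightarrow> norm (reflect u x) = norm x"
  by (simp add: norm_eq_sqrt_inner inner_reflect_reflect)

lemma reflect_self: "norm u = 1 \<Longrightarrow> reflect u u = - u"
  by (simp add: reflect_def norm_eq_1 scaleR_2)

lemma reflect_scaleR: "reflect u (c *\<^sub>R x) = c *\<^sub>R reflect u x"
  by (simp add: reflect_def algebra_simps)

lemma reflect_diff: "reflect u (x - y) = reflect u x - reflect u y"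
  by (simp add: reflect_def inner_diff_right algebra_simps)

lemma reflect_uminus: "reflect u (- x) = - reflect u x"
  by (simp add: reflect_def)

text \<open>Conjugating by an isometry moves the mirror of \<open>u\<close> to the mirror of its
  image; \<open>reflect a\<close> is its own inverse, so it stands on both sides.\<close>

lemma reflect_reflect:
  assumes "norm a = 1"
  shows "reflect (reflect a u) x = reflect a (reflect u (reflect a x))"
proof -
  have "reflect a u \<bullet> x = u \<bullet> reflect a x"
    by (simp add: inner_reflect_left inner_reflect_right)
  then show ?thesis
    using reflect_involution[OF assms, of x]
    by (simp add: reflect_def[of "reflect a u"] reflect_def[of u "reflect a x"] reflect_diff reflect_scaleR)
qed

lemma parallel_unit_vectors:
  assumes "norm u = 1" "norm v = 1" "v = c *\<^sub>R u"
  shows "v = u \<or> v = - u"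
proof -
  have "\<bar>c\<bar> = 1" using assms by simp
  then show ?thesis using assms(3) by (auto simp: abs_if split: if_splits)
qed

text \<open>Evaluating both maps at \<open>v\<close> gives \<open>reflect u v = - v\<close>, which
  forces \<open>v\<close> onto the line of \<open>u\<close>. This bounds the roots per group element
  by two and makes the root system finite.\<close>

lemma reflect_determines_root:
  assumes "norm u = 1" "norm v = 1" "reflect u = reflect v"
  shows "v = u \<or> v = - u"
proof -
  have "v - (2 * (u \<bullet> v)) *\<^sub>R u = - v"
    using reflect_self[OF assms(2)] assms(3) by (metis reflect_def)
  then have "2 *\<^sub>R v = 2 *\<^sub>R ((u \<bullet> v) *\<^sub>R u)" by (simp add: algebra_simps scaleR_2)
  then have "v = (u \<bullet> v) *\<^sub>R u" by (metis scaleR_cancel_left zero_neq_numeral)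
  then show ?thesis using parallel_unit_vectors assms by blast
qed

section \<open>Words in reflections\<close>

fun reflect_word :: "'a::real_inner list \<Rightarrow> 'a \<Rightarrow> 'a" where
  "reflect_word [] x = x"
| "reflect_word (a # ws) x = reflect a (reflect_word ws x)"

lemma reflect_word_append: "reflect_word (vs @ ws) x = reflect_word vs (reflect_word ws x)"
  by (induction vs) auto

lemma inner_reflect_word:
  assumes "\<And>a. a \<in> set ws \<Longrightarrow> norm a = 1"
  shows "reflect_word ws x \<bullet> reflect_word ws y = x \<bullet> y"
  using assms by (induction ws) (auto simp: inner_reflect_reflect)

lemma reflect_word_uminus: "reflect_word ws (- x) = - reflect_word ws x"
  by (induction ws) (auto simp: reflect_uminus)

lemma reflect_reflect_word:
  assumes "\<And>a. a \<in> set ws \<Longrightarrow> norm a = 1"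
  shows "reflect (reflect_word ws u) (reflect_word ws x) = reflect_word ws (reflect u x)"
  using assms by (induction ws) (auto simp: reflect_reflect reflect_involution)

section \<open>Simple roots\<close>

text \<open>The convex cone generated by a finite set. For infinite \<open>D\<close> the sum
  defaults to 0, so only finite sets are meant.\<close>

definition nonneg_span :: "'a::real_vector set \<Rightarrow> 'a set" where
  "nonneg_span D = {\<Sum>d\<in>D. c d *\<^sub>R d | c. \<forall>d\<in>D. (0::real) \<le> c d}"

lemma nonneg_span_subset_insert:
  assumes "finite D" "d \<notin> D" "d \<in> nonneg_span D"
  shows "nonneg_span (insert d D) \<subseteq> nonneg_span D"
proof
  fix z assume "z \<in> nonneg_span (insert d D)"
  then obtain c where c: "\<forall>e\<in>insert d D. 0 \<le> c e" "z = (\<Sum>e\<in>insert d D. c e *\<^sub>R e)"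
    unfolding nonneg_span_def by blast
  obtain b where b: "\<forall>e\<in>D. 0 \<le> b e" "d = (\<Sum>e\<in>D. b e *\<^sub>R e)"
    using assms(3) unfolding nonneg_span_def by blast
  have "z = c d *\<^sub>R d + (\<Sum>e\<in>D. c e *\<^sub>R e)"
    using c(2) assms by simp
  also have "\<dots> = (\<Sum>e\<in>D. (c d * b e + c e) *\<^sub>R e)"
    by (subst b(2)) (simp add: scaleR_sum_right sum.distrib scaleR_add_left)
  finally show "z \<in> nonneg_span D"
    unfolding nonneg_span_def using b(1) c(1) by (auto intro!: exI[of _ "\<lambda>e. c d * b e + c e"])
qed

text \<open>The combinatorics of roots is separated from the matrix group: what enters is a finite
  set of unit vectors stable under its own reflections and the sign of \<open>l\<close> on
  it.\<close>

locale positive_roots =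
  fixes R U :: "'a::real_inner set" and l :: "'a \<Rightarrow> real"
  assumes finite_roots: "finite R"
    and norm_root: "u \<in> R \<Longrightarrow> norm u = 1"
    and reflect_root: "\<lbrakk>a \<in> R; u \<in> R\<rbrakk> \<Longrightarrow> reflect a u \<in> R"
    and positive_root: "u \<in> U \<Longrightarrow> u \<in> R"
    and linear_l: "linear l"
    and l_pos: "u \<in> U \<Longrightarrow> l u > 0"
    and l_neg: "u \<in> R - U \<Longrightarrow> l u < 0"
begin

lemma uminus_root: "u \<in> R \<Longrightarrow> - u \<in> R"
  using reflect_root[of u u] reflect_self[of u] norm_root by simp

lemma l_uminus: "l (- u) = - l u"
  using linear_neg[OF linear_l] by simp

lemma uminus_positive_iff: "u \<in> R \<Longrightarrow> - u \<in> U \<longleftrightarrow> u \<notin> U"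
  using uminus_root[of u] l_uminus[of u] l_pos[of u] l_pos[of "- u"] l_neg[of u] l_neg[of "- u"]
  by force

text \<open>Simplicity is encoded by its effect on signs, the form that exchange arguments need,
  instead of by indecomposability or membership in a basis.\<close>

definition simple_root :: "'a \<Rightarrow> bool" where
  "simple_root a \<longleftrightarrow> a \<in> U \<and> (\<forall>u\<in>U - {a}. reflect a u \<in> U)"

text \<open>If \<open>reflect a\<close> made another positive root \<open>u\<close> negative, then
  \<open>u\<close> and \<open>v = - reflect a u\<close> would be positive with sum a multiple of
  \<open>a\<close>. Expanding both over \<open>D\<close> and collecting the \<open>a\<close> terms
  leads to a contradiction for either sign of the remaining coefficient.\<close>

lemma minimal_generators_simple:
  assumes D: "D \<subseteq> U" and U: "U \<subseteq> nonneg_span D"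
    and minimal: "\<And>E. E \<subset> D \<Longrightarrow> \<not> U \<subseteq> nonneg_span E"
    and a: "a \<in> D"
  shows "simple_root a"
proof (rule ccontr)
  have aU: "a \<in> U" and aR: "a \<in> R" using a D positive_root by auto
  have finD: "finite D" using D positive_root finite_roots by (meson finite_subset subsetI)
  assume "\<not> simple_root a"
  then obtain u where u: "u \<in> U" "u \<noteq> a" "reflect a u \<notin> U"
    using aU unfolding simple_root_def by auto
  define v where "v = - reflect a u"
  define c where "c = 2 * (a \<bullet> u)"
  have v: "v \<in> U"
    unfolding v_def using u uminus_positive_iff reflect_root aR positive_root by blast
  have uv: "u + v = c *\<^sub>R a" by (simp add: v_def c_def reflect_def)
  obtain p where p: "\<forall>d\<in>D. 0 \<le> p d" "u = (\<Sum>d\<in>D. p d *\<^sub>R d)"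
    using u(1) U unfolding nonneg_span_def by blast
  obtain q where q: "\<forall>d\<in>D. 0 \<le> q d" "v = (\<Sum>d\<in>D. q d *\<^sub>R d)"
    using v U unfolding nonneg_span_def by blast
  define E where "E = D - {a}"
  have DE: "D = insert a E" "a \<notin> E" "finite E" using a finD by (auto simp: E_def)
  have p': "u = p a *\<^sub>R a + (\<Sum>d\<in>E. p d *\<^sub>R d)" using p(2) DE by simp
  have q': "v = q a *\<^sub>R a + (\<Sum>d\<in>E. q d *\<^sub>R d)" using q(2) DE by simp
  have eq: "(c - p a - q a) *\<^sub>R a = (\<Sum>d\<in>E. (p d + q d) *\<^sub>R d)"
  proof -
    have "(c - p a - q a) *\<^sub>R a = (u - p a *\<^sub>R a) + (v - q a *\<^sub>R a)"
      using uv by (simp add: algebra_simps)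
    also have "\<dots> = (\<Sum>d\<in>E. p d *\<^sub>R d) + (\<Sum>d\<in>E. q d *\<^sub>R d)"
      using p' q' by (metis add_diff_cancel_left')
    finally show ?thesis by (simp add: sum.distrib scaleR_add_left)
  qed
  show False
  \<comment> \<open>A positive coefficient puts \<open>a\<close> into the cone of the other
    generators, against minimality. Otherwise \<open>l\<close> forces all other coefficients to
    vanish, so \<open>u\<close> is a multiple of \<open>a\<close>.\<close>
  proof (cases "c - p a - q a > 0")
    case True
    define k where "k = c - p a - q a"
    have "a = (1 / k) *\<^sub>R (k *\<^sub>R a)" using True by (simp add: k_def)
    also have "\<dots> = (\<Sum>d\<in>E. ((p d + q d) / k) *\<^sub>R d)"
      unfolding k_def eq by (simp add: scaleR_sum_right k_def)
    finally have "a \<in> nonneg_span E"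
      unfolding nonneg_span_def using True p(1) q(1) DE
      by (auto intro!: exI[of _ "\<lambda>d. (p d + q d) / k"] simp: k_def)
    then have "U \<subseteq> nonneg_span E"
      using nonneg_span_subset_insert[of E a] DE U by auto
    then show False using minimal[of E] a by (auto simp: E_def)
  next
    case False
    have lE: "l d > 0" if "d \<in> E" for d using that D l_pos by (auto simp: E_def)
    have "(\<Sum>d\<in>E. (p d + q d) * l d) = (c - p a - q a) * l a"
      using arg_cong[OF eq, of l] by (simp add: linear_sum[OF linear_l] linear_scale[OF linear_l])
    also have "\<dots> \<le> 0" using False l_pos[OF aU] by (simp add: mult_nonpos_nonneg)
    finally have le: "(\<Sum>d\<in>E. (p d + q d) * l d) \<le> 0" .
    have nonneg: "\<forall>d\<in>E. 0 \<le> (p d + q d) * l d"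
      using p(1) q(1) lE DE by (simp add: less_imp_le)
    have "(\<Sum>d\<in>E. (p d + q d) * l d) = 0"
      using le nonneg by (simp add: antisym sum_nonneg)
    then have "\<forall>d\<in>E. (p d + q d) * l d = 0"
      using nonneg DE(3) by (simp add: sum_nonneg_eq_0_iff)
    then have "p d = 0" if "d \<in> E" for d
      using that lE[OF that] p(1) q(1) DE by (auto simp: add_nonneg_eq_0_iff)
    then have "u = p a *\<^sub>R a" using p' by simp
    then have "u = - a"
      using parallel_unit_vectors[of a u] u norm_root positive_root aR by blast
    then show False using u(1) uminus_positive_iff[OF aR] aU by simp
  qed
qed

text \<open>The finite set \<open>U\<close> generates itself, so it contains an inclusion-minimal
  generating subset, whose members are simple.\<close>

lemma positive_root_simple_combination:
  obtains D where "\<And>d. d \<in> D \<Longrightarrow> simple_root d" "U \<subseteq> nonneg_span D"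
proof -
  have finU: "finite U" using positive_root finite_roots by (meson finite_subset subsetI)
  have UU: "U \<subseteq> nonneg_span U"
  proof
    fix u assume "u \<in> U"
    then have "u = (\<Sum>d\<in>U. (if d = u then 1 else 0) *\<^sub>R d)"
      using finU by (simp add: if_distrib[of "\<lambda>c. c *\<^sub>R _"] cong: if_cong)
    then show "u \<in> nonneg_span U"
      unfolding nonneg_span_def by (auto intro!: exI[of _ "\<lambda>d. if d = u then 1 else 0"])
  qed
  define F where "F = {D. D \<subseteq> U \<and> U \<subseteq> nonneg_span D}"
  have "finite F" "U \<in> F" using finU UU by (auto simp: F_def)
  then obtain D where D: "D \<in> F" "\<And>E. E \<in> F \<Longrightarrow> E \<subseteq> D \<Longrightarrow> D = E"
    using finite_has_minimal[of F] by auto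
  then have DU: "D \<subseteq> U" "U \<subseteq> nonneg_span D" by (auto simp: F_def)
  have "\<not> U \<subseteq> nonneg_span E" if "E \<subset> D" for E
    using D(2)[of E] that DU(1) by (auto simp: F_def)
  then have "simple_root d" if "d \<in> D" for d
    using minimal_generators_simple[OF DU] that by metis
  then show ?thesis using that DU(2) by metis
qed

section \<open>Words in simple reflections: generation and exchange\<close>

lemma exists_simple_root_acute:
  assumes "b \<in> U"
  obtains a where "simple_root a" "a \<bullet> b > 0"
proof -
  obtain D where D: "\<And>d. d \<in> D \<Longrightarrow> simple_root d" "U \<subseteq> nonneg_span D"
    by (rule positive_root_simple_combination) blast
  obtain p where p: "\<forall>d\<in>D. 0 \<le> p d" "b = (\<Sum>d\<in>D. p d *\<^sub>R d)"
    using assms D unfolding nonneg_span_def by blast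
  \<comment> \<open>If every generator had nonpositive product with \<open>b\<close>, the expansion
    of \<open>b \<bullet> b\<close> would be nonpositive.\<close>
  have "\<exists>d\<in>D. d \<bullet> b > 0"
  proof (rule ccontr)
    assume "\<not> ?thesis"
    then have "(\<Sum>d\<in>D. p d * (d \<bullet> b)) \<le> 0"
      using p(1) by (intro sum_nonpos) (simp add: mult_nonneg_nonpos not_less)
    moreover have "b \<bullet> b = (\<Sum>d\<in>D. p d * (d \<bullet> b))"
      by (subst p(2)) (simp add: inner_sum_left)
    ultimately have "b = 0" using inner_ge_zero[of b] inner_eq_zero_iff[of b] by linarith
    then show False using norm_root[OF positive_root[OF assms]] by simp
  qed
  then show ?thesis using that D by blast
qed

lemma simple_root_reflect:
  assumes "simple_root a" "u \<in> U" "reflect a u \<notin> U"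
  shows "u = a"
  using assms unfolding simple_root_def by blast

lemma simple_root_norm: "simple_root a \<Longrightarrow> norm a = 1"
  unfolding simple_root_def using positive_root norm_root by blast

text \<open>Reflecting \<open>b\<close> in a simple root at an acute angle to it keeps it positive
  and lowers \<open>l\<close>, unless the two coincide. The reflection in \<open>b\<close> is then a
  conjugate of one in a lower root.\<close>

lemma reflect_as_simple_word:
  assumes "b \<in> U"
  shows "\<exists>ws. (\<forall>a\<in>set ws. simple_root a) \<and> reflect b = reflect_word ws"
proof -
  \<comment> \<open>Values of \<open>l\<close> are real, so the induction counts the positive roots
    of smaller value.\<close>
  have "\<forall>b. b \<in> U \<longrightarrow> card {u \<in> U. l u < l b} = n \<longrightarrow>
      (\<exists>ws. (\<forall>a\<in>set ws. simple_root a) \<and> reflect b = reflect_word ws)" for n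
  proof (induction n rule: less_induct)
    case (less n)
    show ?case
    proof (intro allI impI)
      fix b assume b: "b \<in> U" and n: "card {u \<in> U. l u < l b} = n"
      obtain a where a: "simple_root a" "a \<bullet> b > 0" using exists_simple_root_acute[OF b] .
      show "\<exists>ws. (\<forall>a\<in>set ws. simple_root a) \<and> reflect b = reflect_word ws"
      proof (cases "b = a")
        case True
        then show ?thesis using a by (intro exI[of _ "[a]"]) auto
      next
        case False
        define b' where "b' = reflect a b"
        have b': "b' \<in> U" using a(1) b False unfolding b'_def simple_root_def by blast
        have aU: "a \<in> U" using a(1) by (simp add: simple_root_def)
        have "l b' = l b - 2 * (a \<bullet> b) * l a"
          unfolding b'_def reflect_def
          by (simp add: linear_diff[OF linear_l] linear_scale[OF linear_l])
        then have lt: "l b' < l b" using a(2) l_pos[OF aU] by simp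
        have "finite U" using positive_root finite_roots by (meson finite_subset subsetI)
        then have "card {u \<in> U. l u < l b'} < card {u \<in> U. l u < l b}"
          using lt b' by (intro psubset_card_mono) auto
        then obtain ws where ws: "\<forall>a\<in>set ws. simple_root a" "reflect b' = reflect_word ws"
          using less.IH n b' by blast
        have "reflect b x = reflect_word (a # ws @ [a]) x" for x
          using reflect_reflect[OF simple_root_norm[OF a(1)], of b' x]
            reflect_involution[OF simple_root_norm[OF a(1)]]
          by (simp add: reflect_word_append b'_def[symmetric] ws(2)[symmetric]) (simp add: b'_def)
        then show ?thesis using ws(1) a(1) by (intro exI[of _ "a # ws @ [a]"]) auto
      qed
    qed
  qed
  then show ?thesis using assms by blast
qed

lemma reflect_eq_positive:
  assumes "s \<in> R"
  obtains b where "b \<in> U" "reflect s = reflect b"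
proof (cases "s \<in> U")
  case True
  then show ?thesis using that by blast
next
  case False
  have "reflect s = reflect (- s)" by (auto simp: reflect_def fun_eq_iff)
  then show ?thesis using that[of "- s"] uminus_positive_iff[OF assms] False by blast
qed

text \<open>The letter that turns the positive root \<open>a\<close> negative is conjugate, under the letters after it,
  to the reflection in \<open>a\<close>, so the two cancel.\<close>

lemma exchange:
  assumes "\<And>b. b \<in> set vs \<Longrightarrow> simple_root b" "a \<in> U" "reflect_word vs a \<notin> U"
  shows "\<exists>ws. length ws < length vs \<and> set ws \<subseteq> set vs \<and>
    (\<forall>x. reflect_word vs (reflect a x) = reflect_word ws x)"
  using assms
proof (induction vs)
  case Nil
  then show ?case by simp
next
  case (Cons b vs)
  show ?case
  proof (cases "reflect_word vs a \<in> U")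
    case False
    then obtain ws where ws: "length ws < length vs" "set ws \<subseteq> set vs"
      "\<forall>x. reflect_word vs (reflect a x) = reflect_word ws x"
      using Cons by auto
    then show ?thesis by (intro exI[of _ "b # ws"]) auto
  next
    case True
    \<comment> \<open>The sign changes exactly at the letter \<open>b\<close>, and a simple
      reflection makes no positive root negative except its own.\<close>
    then have b: "reflect_word vs a = b"
      using simple_root_reflect[of b "reflect_word vs a"] Cons.prems by simp
    have norms: "\<And>c. c \<in> set (b # vs) \<Longrightarrow> norm c = 1" using Cons.prems(1) simple_root_norm by blast
    have "reflect_word (b # vs) (reflect a x) = reflect_word vs x" for x
      using reflect_reflect_word[of vs a x] norms reflect_involution[of b "reflect_word vs x"] b
      by simp
    then show ?thesis by (intro exI[of _ vs]) auto
  qed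
qed

text \<open>The word can be shortened without changing the image of \<open>x\<close>: if
  \<open>x\<close> lies on the mirror of the last letter, that letter is dropped; otherwise the
  exchange property applies. Induction on length ends at the empty word.\<close>

lemma simple_word_chamber_fixed:
  assumes "\<And>b. b \<in> set ws \<Longrightarrow> simple_root b"
    and "\<And>u. u \<in> U \<Longrightarrow> x \<bullet> u \<ge> 0"
    and "\<And>u. u \<in> U \<Longrightarrow> reflect_word ws x \<bullet> u \<ge> 0"
  shows "reflect_word ws x = x"
  using assms
proof (induction "length ws" arbitrary: ws rule: less_induct)
  case less
  show ?case
  proof (cases ws rule: rev_cases)
    case Nil
    then show ?thesis by simp
  next
    case (snoc vs a)
    have a: "simple_root a" "a \<in> U" using less.prems(1) snoc by (auto simp: simple_root_def)
    have vs: "\<And>b. b \<in> set vs \<Longrightarrow> simple_root b" using less.prems(1) snoc by simp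
    have norms: "\<And>b. b \<in> set ws \<Longrightarrow> norm b = 1" using less.prems(1) simple_root_norm by blast
    have "\<exists>ws'. length ws' < length ws \<and> set ws' \<subseteq> set ws \<and> reflect_word ws x = reflect_word ws' x"
    proof (cases "x \<bullet> a = 0")
      case True
      then have "reflect a x = x" by (simp add: reflect_def inner_commute)
      then show ?thesis using snoc by (intro exI[of _ vs]) (auto simp: reflect_word_append)
    next
      case False
      then have pos: "x \<bullet> a > 0" using less.prems(2)[OF a(2)] by simp
      \<comment> \<open>The whole word sends \<open>a\<close> to the negative of this vector. Were
        the vector positive, its product with the image of \<open>x\<close>, which is
        \<open>- (x \<bullet> a)\<close>, would be nonnegative.\<close>
      have "reflect_word vs a \<notin> U"
      proof
        assume "reflect_word vs a \<in> U"
        then have "0 \<le> reflect_word ws x \<bullet> reflect_word vs a" by (rule less.prems(3))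
        also have "reflect_word vs a = - reflect_word ws a"
          using snoc reflect_self[OF simple_root_norm[OF a(1)]]
          by (simp add: reflect_word_append reflect_word_uminus)
        finally have "0 \<le> - (x \<bullet> a)" using inner_reflect_word[OF norms] by simp
        then show False using pos by simp
      qed
      then obtain ws' where "length ws' < length vs" "set ws' \<subseteq> set vs"
          "\<forall>x. reflect_word vs (reflect a x) = reflect_word ws' x"
        using exchange[OF vs a(2)] by blast
      then show ?thesis using snoc by (intro exI[of _ ws']) (auto simp: reflect_word_append)
    qed
    then obtain ws' where ws': "length ws' < length ws" "set ws' \<subseteq> set ws"
      "reflect_word ws x = reflect_word ws' x" by blast
    have "reflect_word ws' x = x"
    proof (rule less.hyps[OF ws'(1)])
      show "simple_root b" if "b \<in> set ws'" for b using that ws'(2) less.prems(1) by blast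
      show "x \<bullet> u \<ge> 0" if "u \<in> U" for u using that by (rule less.prems(2))
      show "reflect_word ws' x \<bullet> u \<ge> 0" if "u \<in> U" for u
        using less.prems(3)[OF that] ws'(3) by simp
    qed
    then show ?thesis using ws'(3) by simp
  qed
qed

end

section \<open>Finite reflection groups\<close>

lemma reflection_matrix_reflect: "reflection_matrix u *v x = reflect u x"
  by (simp add: reflection_matrix_mult reflect_def)

section \<open>Orthogonal matrices as a group\<close>

lemma carrier_orthogonal_group: "g \<in> carrier orthogonal_group \<longleftrightarrow> orthogonal_matrix g"
  by (simp add: orthogonal_group_def)

lemma mult_orthogonal_group: "g \<otimes>\<^bsub>orthogonal_group\<^esub> h = g ** h"
  by (simp add: orthogonal_group_def)

lemma one_orthogonal_group: "\<one>\<^bsub>orthogonal_group\<^esub> = mat 1"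
  by (simp add: orthogonal_group_def)

lemmas orthogonal_group_simps =
  carrier_orthogonal_group mult_orthogonal_group one_orthogonal_group

lemma group_orthogonal_group: "group orthogonal_group"
proof (rule groupI)
  fix g :: "real^'n^'n"
  assume "g \<in> carrier orthogonal_group"
  then show "\<exists>h\<in>carrier orthogonal_group. h \<otimes>\<^bsub>orthogonal_group\<^esub> g = \<one>\<^bsub>orthogonal_group\<^esub>"
    by (intro bexI[of _ "transpose g"])
      (auto simp: orthogonal_group_simps orthogonal_matrix_def)
qed (auto simp: orthogonal_group_simps orthogonal_matrix_mul orthogonal_matrix_id matrix_mul_assoc)

lemma inv_orthogonal_group:
  assumes "orthogonal_matrix g"
  shows "inv\<^bsub>orthogonal_group\<^esub> g = transpose g"
  using assms
  by (intro group.inv_equality[OF group_orthogonal_group])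
    (auto simp: orthogonal_group_simps orthogonal_matrix_def)

lemma orthogonal_matrix_inner:
  fixes g :: "real^'n^'n"
  assumes "orthogonal_matrix g"
  shows "(g *v x) \<bullet> (g *v y) = x \<bullet> y"
  using assms orthogonal_transformation_matrix[of "(*v) g"]
  by (simp add: orthogonal_transformation_def)

text \<open>Keeps \<open>transpose g *v x\<close> visible as the action of an element of
  \<open>G\<close>, instead of rewriting it to a product with the vector on the left.\<close>

declare transpose_matrix_vector [simp del]

lemma transpose_reflection_matrix: "transpose (reflection_matrix u) = reflection_matrix u"
  by (simp add: transpose_def reflection_matrix_def vec_eq_iff matrix_matrix_mult_def
      columnvector_def rowvector_def mat_def mult.commute eq_commute)

text \<open>From an interior point a small step towards \<open>z\<close> would stay in
  \<open>C\<close> and come nearer. Thus the hull condition, known only on the frontier, applies at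
  \<open>x\<close>.\<close>

lemma projection_set_frontier:
  assumes "x \<in> projection_set C z" "x \<noteq> z"
  shows "x \<in> frontier C"
proof -
  have xC: "x \<in> C" using assms(1) by (simp add: projection_set_def)
  have "x \<notin> interior C"
  proof
    assume "x \<in> interior C"
    then obtain e where e: "e > 0" "ball x e \<subseteq> C" by (auto simp: mem_interior)
    \<comment> \<open>The step has length at most \<open>e / 2\<close>, hence stays in the ball;
      \<open>t \<le> 1\<close> keeps \<open>1 - t\<close> nonnegative.\<close>
    define t where "t = min 1 (e / (2 * norm (z - x)))"
    have n: "norm (z - x) > 0" using assms(2) by simp
    have t: "0 < t" "t \<le> 1" using e(1) n by (auto simp: t_def)
    have "t * norm (z - x) \<le> e / (2 * norm (z - x)) * norm (z - x)"
      unfolding t_def using n by (intro mult_right_mono) auto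
    also have "\<dots> < e" using e(1) n by simp
    finally have "x + t *\<^sub>R (z - x) \<in> C"
      using t by (intro subsetD[OF e(2)]) (simp add: dist_norm)
    then have "norm (z - x) \<le> norm (z - (x + t *\<^sub>R (z - x)))"
      using assms(1) by (simp add: projection_set_def)
    also have "z - (x + t *\<^sub>R (z - x)) = (1 - t) *\<^sub>R (z - x)" by (simp add: algebra_simps)
    also have "norm \<dots> = (1 - t) * norm (z - x)" using t by simp
    finally have "t * norm (z - x) \<le> 0" by (simp add: algebra_simps)
    then show False using n t by (simp add: mult_le_0_iff)
  qed
  then show ?thesis using xC closure_subset by (auto simp: frontier_def)
qed

section \<open>The group action and its root system\<close>

locale finite_reflection_group_chamber =
  fixes G :: "(real^'n^'n) set" and U :: "(real^'n) set"
  assumes reflection_group: "finite_reflection_group G"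
    and positive_system: "positive_root_system G U"
begin

lemma finite_G: "finite G"
  using reflection_group by (simp add: finite_reflection_group_def)

lemma subgroup_G: "subgroup G orthogonal_group"
  using reflection_group by (simp add: finite_reflection_group_def)

lemma orthogonal_G: "g \<in> G \<Longrightarrow> orthogonal_matrix g"
  using subgroup.mem_carrier[OF subgroup_G] by (simp add: carrier_orthogonal_group)

lemma mult_G: "\<lbrakk>g \<in> G; h \<in> G\<rbrakk> \<Longrightarrow> g ** h \<in> G"
  using subgroup.m_closed[OF subgroup_G] by (simp add: mult_orthogonal_group)

lemma one_G: "mat 1 \<in> G"
  using subgroup.one_closed[OF subgroup_G] by (simp add: one_orthogonal_group)

lemma transpose_G: "g \<in> G \<Longrightarrow> transpose g \<in> G"
  using subgroup.m_inv_closed[OF subgroup_G, of g] orthogonal_G[of g]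
  by (simp add: inv_orthogonal_group)

lemma exists_maximizer:
  fixes f :: "real^'n^'n \<Rightarrow> real"
  shows "\<exists>g\<in>G. \<forall>h\<in>G. f h \<le> f g"
proof -
  have "Max (f ` G) \<in> f ` G" using finite_G one_G by (intro Max_in) auto
  then obtain g where "g \<in> G" "f g = Max (f ` G)" by force
  then show ?thesis using finite_G by (intro bexI[of _ g]) auto
qed

lemma inner_G: "g \<in> G \<Longrightarrow> (g *v x) \<bullet> (g *v y) = x \<bullet> y"
  using orthogonal_matrix_inner orthogonal_G by blast

lemma norm_G: "g \<in> G \<Longrightarrow> norm (g *v x) = norm x"
  by (simp add: norm_eq_sqrt_inner inner_G)

lemma norm_G_diff: "g \<in> G \<Longrightarrow> norm (g *v x - g *v y) = norm (x - y)"
  using norm_G[of g "x - y"] by (simp add: matrix_vector_mult_diff_distrib)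

lemma transpose_G_cancel:
  assumes "g \<in> G"
  shows "transpose g *v (g *v x) = x" "g *v (transpose g *v x) = x"
  using orthogonal_G[OF assms]
  by (auto simp: orthogonal_matrix_def matrix_vector_mul_assoc)

lemma reflect_root_system:
  assumes "a \<in> root_system G" "u \<in> root_system G"
  shows "reflect a u \<in> root_system G"
proof -
  have a: "norm a = 1" "reflection_matrix a \<in> G" and u: "norm u = 1" "reflection_matrix u \<in> G"
    using assms by (auto simp: root_system_def)
  have "reflection_matrix (reflect a u) =
      reflection_matrix a ** (reflection_matrix u ** reflection_matrix a)"
    by (simp add: matrix_eq reflection_matrix_reflect reflect_reflect[OF a(1)]
        flip: matrix_vector_mul_assoc)
  then show ?thesis using a u by (simp add: root_system_def mult_G norm_reflect)
qed

lemma finite_root_system: "finite (root_system G)"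
proof (rule finite_subset)
  \<comment> \<open>One unit vector is chosen per matrix. Every root is the choice for its own
    reflection up to sign; arbitrary choices at other matrices only enlarge the finite
    cover.\<close>
  let ?f = "\<lambda>m. SOME u. norm u = 1 \<and> reflection_matrix u = m"
  show "root_system G \<subseteq> ?f ` G \<union> uminus ` ?f ` G"
  proof
    fix v assume v: "v \<in> root_system G"
    define u where "u = ?f (reflection_matrix v)"
    have u: "norm u = 1 \<and> reflection_matrix u = reflection_matrix v"
      unfolding u_def by (rule someI[of _ v]) (use v in \<open>simp add: root_system_def\<close>)
    then have "reflect u = reflect v"
      by (auto simp flip: reflection_matrix_reflect)
    then have "v = u \<or> v = - u"
      using u v by (intro reflect_determines_root) (auto simp: root_system_def)
    moreover have "u \<in> ?f ` G" using v unfolding u_def root_system_def by blast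
    ultimately show "v \<in> ?f ` G \<union> uminus ` ?f ` G" by blast
  qed
  show "finite (?f ` G \<union> uminus ` ?f ` G)" using finite_G by blast
qed

text \<open>One separating functional is fixed by choice, so that it can serve as the parameter
  \<open>l\<close> of \<open>positive_roots\<close>.\<close>

definition height :: "real^'n \<Rightarrow> real" where
  "height = (SOME l. linear l \<and> (\<forall>u\<in>U. l u > 0) \<and> (\<forall>u\<in>root_system G - U. l u < 0))"

lemma height:
  "linear height" "\<And>u. u \<in> U \<Longrightarrow> height u > 0" "\<And>u. u \<in> root_system G - U \<Longrightarrow> height u < 0"
proof -
  have "\<exists>l. linear l \<and> (\<forall>u\<in>U. l u > 0) \<and> (\<forall>u\<in>root_system G - U. l u < (0::real))"
    using positive_system unfolding positive_root_system_def by blast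
  from someI_ex[OF this] show "linear height" "\<And>u. u \<in> U \<Longrightarrow> height u > 0"
    "\<And>u. u \<in> root_system G - U \<Longrightarrow> height u < 0"
    unfolding height_def by blast+
qed

sublocale positive_roots "root_system G" U height
proof (rule positive_roots.intro)
  show "u \<in> root_system G" if "u \<in> U" for u
    using that positive_system unfolding positive_root_system_def by blast
  show "norm u = 1" if "u \<in> root_system G" for u
    using that by (simp add: root_system_def)
qed (fact finite_root_system reflect_root_system height)+

section \<open>Existence and uniqueness of chamber representatives\<close>

lemma group_element_simple_word:
  assumes "g \<in> G"
  shows "\<exists>ws. (\<forall>a\<in>set ws. simple_root a) \<and> (\<forall>x. g *v x = reflect_word ws x)"
proof -
  obtain S where S: "\<And>s. s \<in> S \<Longrightarrow> norm s = 1"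
      "G = generate orthogonal_group (reflection_matrix ` S)"
    using reflection_group unfolding finite_reflection_group_def by blast
  have gen: "\<exists>ws. (\<forall>a\<in>set ws. simple_root a) \<and> (\<forall>x. reflection_matrix s *v x = reflect_word ws x)"
    if "s \<in> S" for s
  proof -
    have "s \<in> root_system G"
      using S that generate.incl[of _ "reflection_matrix ` S" orthogonal_group]
      by (auto simp: root_system_def)
    then obtain b where "b \<in> U" "reflect s = reflect b" by (rule reflect_eq_positive)
    then show ?thesis using reflect_as_simple_word[of b] by (auto simp: reflection_matrix_reflect)
  qed
  have "g \<in> generate orthogonal_group (reflection_matrix ` S)" using assms S(2) by simp
  then show ?thesis
  proof (induction rule: generate.induct)
    case one
    show ?case by (intro exI[of _ "[]"]) (simp add: one_orthogonal_group)
  next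
    case (incl h)
    then show ?case using gen by blast
  next
    case (inv h)
    then obtain s where s: "s \<in> S" "h = reflection_matrix s" by blast
    have "h \<in> G" unfolding S(2) using inv by (rule generate.incl)
    \<comment> \<open>A reflection matrix is symmetric and orthogonal, so inverses of generators
      give no new letters.\<close>
    then have "inv\<^bsub>orthogonal_group\<^esub> h = h"
      using s by (simp add: inv_orthogonal_group orthogonal_G transpose_reflection_matrix)
    then show ?case using gen s by simp
  next
    case (eng h k)
    from eng.IH(1) obtain vs
      where "\<forall>a\<in>set vs. simple_root a" "\<forall>x. h *v x = reflect_word vs x" by blast
    moreover from eng.IH(2) obtain ws
      where "\<forall>a\<in>set ws. simple_root a" "\<forall>x. k *v x = reflect_word ws x" by blast
    ultimately show ?case
      by (intro exI[of _ "vs @ ws"])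
        (auto simp: mult_orthogonal_group reflect_word_append simp flip: matrix_vector_mul_assoc)
  qed
qed

lemma closed_chamber_fixed:
  assumes "g \<in> G" "x \<in> closed_chamber U" "g *v x \<in> closed_chamber U"
  shows "g *v x = x"
proof -
  obtain ws where "\<forall>a\<in>set ws. simple_root a" "\<forall>x. g *v x = reflect_word ws x"
    using group_element_simple_word[OF assms(1)] by blast
  then show ?thesis
    using simple_word_chamber_fixed[of ws x] assms(2,3) by (simp add: closed_chamber_def)
qed

text \<open>Two chamber points of one orbit differ by an element of \<open>G\<close>, which must fix
  the first of them. This makes the description in \<open>chamber_rep\<close> proper.\<close>

lemma chamber_rep_eq:
  assumes "g \<in> G" "g *v x \<in> closed_chamber U"
  shows "chamber_rep G U x = g *v x"
  unfolding chamber_rep_def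
proof (rule the_equality)
  show "g *v x \<in> group_orbit G x \<inter> closed_chamber U"
    using assms by (auto simp: group_orbit_def)
  fix z assume "z \<in> group_orbit G x \<inter> closed_chamber U"
  then obtain h where h: "h \<in> G" "z = h *v x" "z \<in> closed_chamber U"
    by (auto simp: group_orbit_def)
  have "(h ** transpose g) *v (g *v x) = z"
    using h(2) transpose_G_cancel[OF assms(1)] by (simp flip: matrix_vector_mul_assoc)
  then show "z = g *v x"
    using closed_chamber_fixed[of "h ** transpose g" "g *v x"] assms h mult_G transpose_G by simp
qed

text \<open>A point of maximal \<open>height\<close> in the orbit works: if it had negative product
  with a positive root, reflecting in that root would raise the height.\<close>

lemma exists_in_chamber: "\<exists>g\<in>G. g *v x \<in> closed_chamber U"
proof -
  obtain g where g: "g \<in> G" "\<And>h. h \<in> G \<Longrightarrow> height (h *v x) \<le> height (g *v x)"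
    using exists_maximizer[of "\<lambda>g. height (g *v x)"] by blast
  have "(g *v x) \<bullet> u \<ge> 0" if "u \<in> U" for u
  proof (rule ccontr)
    assume "\<not> ?thesis"
    then have neg: "u \<bullet> (g *v x) < 0" by (simp add: inner_commute)
    have "reflection_matrix u ** g \<in> G"
      using positive_root[OF that] g(1) by (auto simp: root_system_def intro: mult_G)
    from g(2)[OF this] have "height (reflect u (g *v x)) \<le> height (g *v x)"
      by (simp add: reflection_matrix_reflect flip: matrix_vector_mul_assoc)
    then have "0 \<le> height u * (u \<bullet> (g *v x))"
      by (simp add: mult.commute reflect_def linear_diff[OF linear_l] linear_scale[OF linear_l])
    then show False using neg l_pos[OF that] by (auto simp: zero_le_mult_iff)
  qed
  then show ?thesis using g(1) by (auto simp: closed_chamber_def)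
qed

text \<open>Any \<open>g\<close> that carries \<open>x + y\<close> into the chamber serves both
  vectors: for each positive root the pairings with \<open>g *v x\<close> and \<open>g *v y\<close>
  have nonnegative product and nonnegative sum.\<close>

lemma common_chamber_element:
  assumes "\<And>g. g \<in> G \<Longrightarrow> (g *v x) \<bullet> y \<le> x \<bullet> y"
  obtains g where "g \<in> G" "chamber_rep G U x = g *v x" "chamber_rep G U y = g *v y"
proof -
  obtain g where g: "g \<in> G" "g *v (x + y) \<in> closed_chamber U" using exists_in_chamber by blast
  have both: "(g *v x) \<bullet> u \<ge> 0 \<and> (g *v y) \<bullet> u \<ge> 0" if u: "u \<in> U" for u
  proof -
    have uG: "reflection_matrix u \<in> G"
      using positive_root[OF u] by (auto simp: root_system_def)
    \<comment> \<open>The hypothesis is tested on the reflection in \<open>u\<close>, conjugated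
      back by \<open>g\<close>.\<close>
    have "reflect u (g *v x) \<bullet> (g *v y) = ((transpose g ** reflection_matrix u ** g) *v x) \<bullet> y"
      using inner_G[OF g(1), of "transpose g *v reflect u (g *v x)" y] transpose_G_cancel[OF g(1)]
      by (simp add: reflection_matrix_reflect flip: matrix_vector_mul_assoc)
    also have "\<dots> \<le> x \<bullet> y" 
      by (rule assms[OF mult_G[OF mult_G[OF transpose_G[OF g(1)] uG] g(1)]])
    also have "\<dots> = (g *v x) \<bullet> (g *v y)" by (simp add: inner_G g(1))
    finally have "(u \<bullet> (g *v x)) * (u \<bullet> (g *v y)) \<ge> 0" by (simp add: inner_reflect_left)
    then have "((g *v x) \<bullet> u) * ((g *v y) \<bullet> u) \<ge> 0" by (simp add: inner_commute)
    moreover have "(g *v x) \<bullet> u + (g *v y) \<bullet> u \<ge> 0"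
      using g(2) u by (simp add: closed_chamber_def matrix_vector_right_distrib inner_add_left)
    ultimately show ?thesis by (auto simp: zero_le_mult_iff)
  qed
  then have "g *v x \<in> closed_chamber U" "g *v y \<in> closed_chamber U"
    by (auto simp: closed_chamber_def)
  then show ?thesis using that g(1) chamber_rep_eq by blast
qed

text \<open>Replacing \<open>x\<close> by the point of its orbit with the largest product with
  \<open>y\<close> keeps the representative and makes \<open>common_chamber_element\<close>
  applicable; the common element preserves that product.\<close>

lemma inner_le_inner_chamber_rep:
  assumes "h \<in> G"
  shows "(h *v x) \<bullet> y \<le> chamber_rep G U x \<bullet> chamber_rep G U y"
proof -
  obtain g where g: "g \<in> G" "\<And>h. h \<in> G \<Longrightarrow> (h *v x) \<bullet> y \<le> (g *v x) \<bullet> y"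
    using exists_maximizer[of "\<lambda>g. (g *v x) \<bullet> y"] by blast
  have "(h *v (g *v x)) \<bullet> y \<le> (g *v x) \<bullet> y" if "h \<in> G" for h
    using g(2)[OF mult_G[OF that g(1)]] by (simp add: matrix_vector_mul_assoc)
  then obtain k where k: "k \<in> G" "chamber_rep G U (g *v x) = k *v (g *v x)"
      "chamber_rep G U y = k *v y"
    by (rule common_chamber_element)
  obtain m where m: "m \<in> G" "m *v (g *v x) \<in> closed_chamber U" using exists_in_chamber by blast
  have "chamber_rep G U x = chamber_rep G U (g *v x)"
    using chamber_rep_eq[OF m] chamber_rep_eq[of "m ** g" x] m mult_G[OF m(1) g(1)]
    by (simp add: matrix_vector_mul_assoc)
  then show ?thesis using k g(2)[OF assms] by (simp add: inner_G)
qed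

section \<open>Proximal normals under the group action\<close>

lemma finite_group_orbit: "finite (group_orbit G x)"
  unfolding group_orbit_def using finite_G by simp

text \<open>Elements of \<open>G\<close> are isometries that map \<open>C\<close> onto itself, so
  they carry nearest points to nearest points.\<close>

lemma proximal_normal_cone_image:
  assumes C: "group_invariant G C" and g: "g \<in> G" and y: "y \<in> proximal_normal_cone C x"
  shows "g *v y \<in> proximal_normal_cone C (g *v x)"
proof -
  obtain c z where cz: "c \<ge> 0" "y = c *\<^sub>R (z - x)" "x \<in> projection_set C z"
    using y unfolding proximal_normal_cone_def by blast
  have img: "(*v) g ` C = C" using C g by (auto simp: group_invariant_def)
  have "g *v x \<in> C" using img cz(3) by (auto simp: projection_set_def)
  moreover have "norm (g *v z - g *v x) \<le> norm (g *v z - w)" if "w \<in> C" for w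
  proof -
    have "w \<in> (*v) g ` C" using that img by simp
    then obtain w' where "w' \<in> C" "w = g *v w'" by blast
    then show ?thesis
      using cz(3) by (simp add: projection_set_def norm_G_diff[OF g])
  qed
  ultimately have "g *v x \<in> projection_set C (g *v z)" by (simp add: projection_set_def)
  moreover have "g *v y = c *\<^sub>R (g *v z - g *v x)"
    using cz(2) by (simp add: matrix_vector_mult_diff_distrib matrix_vector_mult_scaleR)
  ultimately show ?thesis unfolding proximal_normal_cone_def using cz(1) by blast
qed

lemma proximal_normal_cone_image_iff:
  assumes "group_invariant G C" "g \<in> G"
  shows "g *v y \<in> proximal_normal_cone C (g *v x) \<longleftrightarrow> y \<in> proximal_normal_cone C x"
  using proximal_normal_cone_image[OF assms] transpose_G_cancel[OF assms(2)]
    proximal_normal_cone_image[OF assms(1) transpose_G[OF assms(2)], of "g *v y" "g *v x"]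
  by auto

text \<open>Unless \<open>y\<close> is 0, \<open>x\<close> is a frontier point, so the hull of its
  orbit lies in \<open>C\<close> and \<open>x\<close> is still nearest to \<open>z\<close> there.
  The obtuse angle criterion for closed convex sets gives the inequality.\<close>

lemma proximal_normal_orbit_max:
  assumes hull: "\<And>z. z \<in> frontier C \<Longrightarrow> convex hull (group_orbit G z) \<subseteq> C"
    and y: "y \<in> proximal_normal_cone C x" and g: "g \<in> G"
  shows "(g *v x) \<bullet> y \<le> x \<bullet> y"
proof -
  obtain c z where cz: "c \<ge> 0" "y = c *\<^sub>R (z - x)" "x \<in> projection_set C z"
    using y unfolding proximal_normal_cone_def by blast
  show ?thesis
  proof (cases "x = z")
    case True
    then show ?thesis using cz by simp
  next
    case False
    let ?H = "convex hull (group_orbit G x)"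
    have "?H \<subseteq> C" using hull projection_set_frontier[OF cz(3) False] by blast
    then have closest: "\<forall>w\<in>?H. dist z x \<le> dist z w"
      using cz(3) by (auto simp: projection_set_def dist_norm)
    have "mat 1 *v x \<in> group_orbit G x" "g *v x \<in> group_orbit G x"
      using one_G g unfolding group_orbit_def by blast+
    then have mem: "x \<in> ?H" "g *v x \<in> ?H" by (auto intro: hull_inc)
    have "closed ?H"
      by (intro compact_imp_closed finite_imp_compact_convex_hull finite_group_orbit)
    then have "(z - x) \<bullet> (g *v x - x) \<le> 0"
      using any_closest_point_dot[of ?H x "g *v x" z] mem closest by simp
    then have "c * ((z - x) \<bullet> (g *v x - x)) \<le> 0" using cz(1) by (simp add: mult_nonneg_nonpos)
    then have "y \<bullet> (g *v x - x) \<le> 0" using cz(2) by simp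
    then show ?thesis by (simp add: inner_diff_right inner_commute)
  qed
qed

end

theorem theorem3:
  fixes G :: "(real^'n^'n) set" and U C :: "(real^'n) set" and x y :: "real^'n"
  assumes "finite_reflection_group G"
    and "positive_root_system G U"
    and "group_invariant G C"
    and "\<And>z. z \<in> frontier C \<Longrightarrow> convex hull (group_orbit G z) \<subseteq> C"
    and "x \<in> C"
  shows "y \<in> proximal_normal_cone C x \<longleftrightarrow>
           chamber_rep G U y \<in> proximal_normal_cone C (chamber_rep G U x) \<and>
           chamber_rep G U x \<bullet> chamber_rep G U y = x \<bullet> y"
proof -
  interpret finite_reflection_group_chamber G U
    by unfold_locales (fact assms)+
  \<comment> \<open>Orbit maximality is common to both directions: it yields one \<open>g\<close>
    for both representatives, and \<open>g\<close> preserves normality and the inner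
    product.\<close>
  have reduce: ?thesis if max: "\<And>g. g \<in> G \<Longrightarrow> (g *v x) \<bullet> y \<le> x \<bullet> y"
  proof -
    obtain g where "g \<in> G" "chamber_rep G U x = g *v x" "chamber_rep G U y = g *v y"
      using max by (rule common_chamber_element)
    then show ?thesis using proximal_normal_cone_image_iff[OF assms(3)] inner_G by simp
  qed
  show ?thesis
  proof
    assume "y \<in> proximal_normal_cone C x"
    then show "chamber_rep G U y \<in> proximal_normal_cone C (chamber_rep G U x) \<and>
        chamber_rep G U x \<bullet> chamber_rep G U y = x \<bullet> y"
      using reduce proximal_normal_orbit_max[of C y x] assms(4) by blast
  next
    assume eq: "chamber_rep G U y \<in> proximal_normal_cone C (chamber_rep G U x) \<and>
        chamber_rep G U x \<bullet> chamber_rep G U y = x \<bullet> y"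
    \<comment> \<open>The assumed equality turns the general bound by the representatives into orbit
      maximality at \<open>x\<close>.\<close>
    then have "(g *v x) \<bullet> y \<le> x \<bullet> y" if "g \<in> G" for g
      using inner_le_inner_chamber_rep[OF that, of x y] by simp
    then show "y \<in> proximal_normal_cone C x" using reduce eq by blast
  qed
qed

end
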